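(* Let $X,Y,Z$ be normed spaces, $Y_+\subset Y$ a non-trivial convex cone, $\Omega\subset X$, $F:\Omega\rightrightarrows Y$ and $G:\Omega\rightrightarrows Z$ set-valued maps, and $U\subset Z$ an open neighborhood of $0_Z$. Let $V:U\rightrightarrows Y$, $V(z):=\bigcup_{x\in\Omega,\ z\in G(x)}F(x)$, and assume $V(z)\neq\varnothing$ for every $z\in U$. Let $y_0\in Y$ be nondominated by $V(0_Z)$, i.e. $V(0_Z)\cap(y_0-Y_+)\subset y_0+Y_+$ (written $y_0\in \mathrm{ND}(P(0_Z))$), and let $\Gamma_{y_0}$ be the set of all $\Delta\in P(Z,Y)$ such that (a) $\operatorname{core}(\operatorname{Gph}(\Delta))\neq\varnothing$; (b) $Y_+\subseteq\Delta(0_Z)$ and $(-Y_+)\cap\Delta(0_Z)\subseteq Y_+$; (c) $\operatorname{Gph}(-\Delta)\cap[\operatorname{Gph}(V)-(0_Z,y_0)]\subseteq\{0_{Z\times Y}\}$. Assume $\Gamma_{y_0}\neq\varnothing$. Then every $\Delta\in\Gamma_{y_0}$ is a Lagrange multiplier of $(P(0_Z))$ at $y_0$; that is, $y_0$ is a nondominated point of the program "Minimize $F(x)+\Delta(G(x))$ subject to $x\in\Omega$" (denoted $(P[\Delta])$), meaning $$\Bigl(\bigcup_{x\in\Omega}\bigl(F(x)+\Delta(G(x))\bigr)\Bigr)\cap(y_0-Y_+)\subset y_0+Y_+ .$$ Furthermore, if $y_0$ is a minimal point of $(P(0_Z))$, that is, if $y_0\in F(x_0)$ for some $x_0\in\Omega$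 with $0_Z\in G(x_0)$, then $y_0$ is also a minimal point of $(P[\Delta])$ achieved at $x_0$ (i.e. in addition $y_0\in F(x_0)+\Delta(G(x_0))$), and $$\Delta(G(x_0))\cap(-Y_+)\subseteq Y_+ .$$
   Context: All normed spaces are real. A cone is a nonempty set $K$ with $\alpha K\subset K$ for all $\alpha\ge 0$; a cone $K\subset Y$ is non-trivial if $\{0_Y\}\subsetneq K\subsetneq Y$. $(P(0_Z))$ is the program "Minimize $F(x)$ subject to $x\in\Omega$, $0_Z\in G(x)$". For a set-valued map $\Delta$, $\operatorname{Gph}(\Delta)=\{(z,y): y\in\Delta(z)\}$, $\operatorname{Dom}(\Delta)=\{z:\Delta(z)\ne\varnothing\}$, $\Delta(A)=\bigcup_{a\in A}\Delta(a)$, and $(-\Delta)(z):=-\Delta(z)$, so $\operatorname{Gph}(-\Delta)=\{(z,-y):(z,y)\in\operatorname{Gph}(\Delta)\}$. $P(Z,Y)$ is the set of all $\Delta:Z\rightrightarrows Y$ whose graph is a closed convex cone and with $\operatorname{Dom}(\Delta)=Z$ (proper closed convex processes). Sums of sets are Minkowski sums, with $A+\varnothing=\varnothing$. For a subset $A$ of a vector space $E$, $\operatorname{core}(A)=\{a\in A:\forall x\in E\ \exists\delta>0,\ a+[0,\delta]x\subset A\}$.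
   Formalization: In condition (c), Gph(V) is taken over all z in Z by the defining formula of V, not only over z in U; with the graph cut down to U the claim fails when G(Ω) leaves U (e.g. G(x)={x}, F(x)={|x|} on U=(-1,1), {-1} off U, Δ(z)=[0,∞), y_0=0). *)

theory Defs
  imports "HOL-Analysis.Analysis"
begin

(* A set-valued map from A to B is a function into 'b set, possibly with empty values; a map
   whose source is a proper subset of the type is only ever evaluated on that subset. *)

definition gph :: "('a \<Rightarrow> 'b set) \<Rightarrow> ('a \<times> 'b) set" where
  "gph D = {(z, y). y \<in> D z}"

definition sv_dom :: "('a \<Rightarrow> 'b set) \<Rightarrow> 'a set" where
  "sv_dom D = {z. D z \<noteq> {}}"

definition sv_image :: "('a \<Rightarrow> 'b set) \<Rightarrow> 'a set \<Rightarrow> 'b set" where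
  "sv_image D A = (\<Union>a\<in>A. D a)"

definition sv_neg :: "('a \<Rightarrow> 'b::uminus set) \<Rightarrow> 'a \<Rightarrow> 'b set" where
  "sv_neg D = (\<lambda>z. uminus ` D z)"

(* The library predicate cone also holds for the empty set, hence the nonemptiness conditions. *)

definition nontrivial_convex_cone :: "'a::real_vector set \<Rightarrow> bool" where
  "nontrivial_convex_cone K \<longleftrightarrow> K \<noteq> {} \<and> cone K \<and> convex K \<and> {0} \<subset> K \<and> K \<subset> UNIV"

definition proper_closed_convex_processes ::
    "('z::real_normed_vector \<Rightarrow> 'y::real_normed_vector set) set" where
  "proper_closed_convex_processes =
     {D. gph D \<noteq> {} \<and> cone (gph D) \<and> convex (gph D) \<and> closed (gph D) \<and> sv_dom D = UNIV}"

definition alg_core :: "'a::real_vector set \<Rightarrow> 'a set" where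
  "alg_core A = {a \<in> A. \<forall>x. \<exists>\<delta>>0. \<forall>t\<in>{0..\<delta>}. a + t *\<^sub>R x \<in> A}"

(* S is the set of all objective values of a program. The point y0 need not belong to S, and
   Yp need not be pointed. *)
definition nondominated :: "'y::ab_group_add set \<Rightarrow> 'y set \<Rightarrow> 'y \<Rightarrow> bool" where
  "nondominated Yp S y0 \<longleftrightarrow> S \<inter> (\<lambda>k. y0 - k) ` Yp \<subseteq> (\<lambda>k. y0 + k) ` Yp"

(* The defining formula makes sense at every z, and gph (value_map Omega F G) ranges over all z.
   The neighborhood U of 0 enters only as a region where the values are required to be nonempty.
   Cutting the graph down to U would give no control over those x in Omega for which G x leaves U,
   although they compete in the program with objective F x + D (G x): take Omega and all spaces to
   be the real line, G x = {x}, Yp = {0..}, y0 = 0, U = {-1<..<1}, F x = {\<bar>x\<bar>} for x in U,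
   F x = {-1} otherwise, D z = {0..}. *)
definition value_map ::
    "'x set \<Rightarrow> ('x \<Rightarrow> 'y set) \<Rightarrow> ('x \<Rightarrow> 'z set) \<Rightarrow> 'z \<Rightarrow> 'y set" where
  "value_map \<Omega> F G z = (\<Union>x\<in>{x \<in> \<Omega>. z \<in> G x}. F x)"

definition Gamma_set ::
    "'y::real_normed_vector set \<Rightarrow> ('z::real_normed_vector \<Rightarrow> 'y set) \<Rightarrow> 'y
     \<Rightarrow> ('z \<Rightarrow> 'y set) set" where
  "Gamma_set Yp V y0 =
     {D \<in> proper_closed_convex_processes.
        alg_core (gph D) \<noteq> {} \<and>
        Yp \<subseteq> D 0 \<and> uminus ` Yp \<inter> D 0 \<subseteq> Yp \<and>
        gph (sv_neg D) \<inter> (\<lambda>p. p - (0, y0)) ` gph V \<subseteq> {0}}"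

(* The plus sign is the Minkowski sum of sets. *)
definition lagrangian ::
    "('x \<Rightarrow> 'y::plus set) \<Rightarrow> ('x \<Rightarrow> 'z set) \<Rightarrow> ('z \<Rightarrow> 'y set) \<Rightarrow> 'x \<Rightarrow> 'y set" where
  "lagrangian F G D x = F x + sv_image D (G x)"

definition lagrange_multiplier ::
    "'y::ab_group_add set \<Rightarrow> 'x set \<Rightarrow> ('x \<Rightarrow> 'y set) \<Rightarrow> ('x \<Rightarrow> 'z set)
     \<Rightarrow> ('z \<Rightarrow> 'y set) \<Rightarrow> 'y \<Rightarrow> bool" where
  "lagrange_multiplier Yp \<Omega> F G D y0 \<longleftrightarrow>
     nondominated Yp (\<Union>x\<in>\<Omega>. lagrangian F G D x) y0"

(* y0 is a minimal point, achieved at x0, of: Minimize H x subject to x in A. *)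
definition minimal_at ::
    "'y::ab_group_add set \<Rightarrow> 'x set \<Rightarrow> ('x \<Rightarrow> 'y set) \<Rightarrow> 'y \<Rightarrow> 'x \<Rightarrow> bool" where
  "minimal_at Yp A H y0 x0 \<longleftrightarrow> nondominated Yp (\<Union>x\<in>A. H x) y0 \<and> x0 \<in> A \<and> y0 \<in> H x0"

end

theory Submission
  imports Defs
begin

text \<open>
  If \<open>f + d = y0 - k\<close> with \<open>f \<in> F x\<close>, \<open>z \<in> G x\<close>, \<open>d \<in> \<Delta> z\<close> and \<open>k \<in> Yp\<close>, then \<open>y0 - f = d + k\<close>
  lies in \<open>\<Delta> z + \<Delta> 0 \<subseteq> \<Delta> z\<close>, so condition (c) forces \<open>z = 0\<close> and \<open>f = y0\<close>. Hence
  \<open>d = - k\<close> belongs to \<open>- Yp \<inter> \<Delta> 0\<close>, which is contained in \<open>Yp\<close> by (b).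
\<close>

text \<open>A convex cone is closed under addition, and here the cone is the graph. The case
  \<open>z' = 0\<close> gives \<open>D z + D 0 \<subseteq> D z\<close>, which lets elements of
  \<open>Yp \<subseteq> D 0\<close> be absorbed into any value of \<open>D\<close>.\<close>

lemma process_add:
  assumes "D \<in> proper_closed_convex_processes" "y \<in> D z" "y' \<in> D z'"
  shows "y + y' \<in> D (z + z')"
proof -
  have "convex (gph D)" "cone (gph D)"
    using assms(1) by (auto simp: proper_closed_convex_processes_def)
  then have "\<forall>p\<in>gph D. \<forall>q\<in>gph D. p + q \<in> gph D"
    using convex_cone by blast
  moreover have "(z, y) \<in> gph D" "(z', y') \<in> gph D"
    using assms by (auto simp: gph_def)
  ultimately have "(z, y) + (z', y') \<in> gph D"
    by blast
  then show ?thesis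
    by (simp add: gph_def)
qed

text \<open>A nonempty cone contains the origin. This is what makes a feasible objective value also
  a value of the Lagrangian.\<close>

lemma process_zero:
  assumes "D \<in> proper_closed_convex_processes"
  shows "0 \<in> D 0"
proof -
  have "0 \<in> gph D"
    using assms cone_contains_0 unfolding proper_closed_convex_processes_def by blast
  then show ?thesis
    by (simp add: gph_def zero_prod_def)
qed

lemma in_lagrangianI:
  "f \<in> F x \<Longrightarrow> z \<in> G x \<Longrightarrow> d \<in> D z \<Longrightarrow> f + d \<in> lagrangian F G D x"
  unfolding lagrangian_def sv_image_def by (auto intro: set_plus_intro)

lemma in_lagrangianE:
  assumes "y \<in> lagrangian F G D x"
  obtains f z d where "f \<in> F x" "z \<in> G x" "d \<in> D z" "y = f + d"
  using assms unfolding lagrangian_def sv_image_def set_plus_def by blast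

lemma Gamma_set_lagrange_multiplier:
  assumes D: "D \<in> Gamma_set Yp (value_map \<Omega> F G) y0"
  shows "lagrange_multiplier Yp \<Omega> F G D y0"
  unfolding lagrange_multiplier_def nondominated_def
proof
  have proc: "D \<in> proper_closed_convex_processes"
    and Yp: "Yp \<subseteq> D 0" "uminus ` Yp \<inter> D 0 \<subseteq> Yp"
    and sep: "gph (sv_neg D) \<inter> (\<lambda>p. p - (0, y0)) ` gph (value_map \<Omega> F G) \<subseteq> {0}"
    using D by (auto simp: Gamma_set_def)
  fix y
  assume "y \<in> (\<Union>x\<in>\<Omega>. lagrangian F G D x) \<inter> (\<lambda>k. y0 - k) ` Yp"
  then obtain x k where x: "x \<in> \<Omega>" "y \<in> lagrangian F G D x" and k: "k \<in> Yp" "y = y0 - k"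
    by blast
  from x(2) obtain f z d where *: "f \<in> F x" "z \<in> G x" "d \<in> D z" "y = f + d"
    by (rule in_lagrangianE)
  have "d + k \<in> D z"
    using process_add[OF proc *(3), of k 0] Yp(1) k(1) by auto
  moreover have "f - y0 = - (d + k)"
    using *(4) k(2) by (simp add: algebra_simps)
  ultimately have "(z, f - y0) \<in> gph (sv_neg D)"
    unfolding gph_def sv_neg_def by blast
  \<comment> \<open>The same point comes from the translated graph of the value map:
    \<open>x\<close> satisfies the constraint perturbed by \<open>z\<close>, so \<open>f\<close> is
    a value there.\<close>
  moreover have "(z, f - y0) \<in> (\<lambda>p. p - (0, y0)) ` gph (value_map \<Omega> F G)"
    using x(1) * by (intro image_eqI[where x = "(z, f)"]) (auto simp: gph_def value_map_def)
  ultimately have "(z, f - y0) = 0"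
    using sep by blast
  then have zf: "z = 0" "f = y0"
    by (auto simp: zero_prod_def)
  with k *(4) have "d = - k"
    by simp
  with k(1) *(3) zf(1) Yp(2) have "d \<in> Yp"
    by blast
  then show "y \<in> (\<lambda>k. y0 + k) ` Yp"
    using *(4) zf(2) by blast
qed

theorem theorem3p5:
  fixes \<Omega> :: "'x::real_normed_vector set"
    and Yp :: "'y::real_normed_vector set"
    and U :: "'z::real_normed_vector set"
    and F :: "'x \<Rightarrow> 'y set"
    and G :: "'x \<Rightarrow> 'z set"
    and y0 :: 'y
  assumes "nontrivial_convex_cone Yp"
    and "open U" and "0 \<in> U"
    and "\<forall>z\<in>U. value_map \<Omega> F G z \<noteq> {}"
    and "nondominated Yp (value_map \<Omega> F G 0) y0"
    and "Gamma_set Yp (value_map \<Omega> F G) y0 \<noteq> {}"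
  shows "\<forall>\<Delta> \<in> Gamma_set Yp (value_map \<Omega> F G) y0.
           lagrange_multiplier Yp \<Omega> F G \<Delta> y0 \<and>
           (\<forall>x0. minimal_at Yp {x \<in> \<Omega>. 0 \<in> G x} F y0 x0 \<longrightarrow>
              minimal_at Yp \<Omega> (lagrangian F G \<Delta>) y0 x0 \<and>
              sv_image \<Delta> (G x0) \<inter> uminus ` Yp \<subseteq> Yp)"
proof (intro ballI conjI allI impI)
  fix \<Delta>
  assume D: "\<Delta> \<in> Gamma_set Yp (value_map \<Omega> F G) y0"
  show mult: "lagrange_multiplier Yp \<Omega> F G \<Delta> y0"
    by (rule Gamma_set_lagrange_multiplier[OF D])
  fix x0
  assume "minimal_at Yp {x \<in> \<Omega>. 0 \<in> G x} F y0 x0"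
  then have x0: "x0 \<in> \<Omega>" "0 \<in> G x0" "y0 \<in> F x0"
    by (auto simp: minimal_at_def)
  have "0 \<in> \<Delta> 0"
    using D process_zero by (auto simp: Gamma_set_def)
  \<comment> \<open>Write \<open>y0 = y0 + 0\<close>, choosing \<open>0 \<in> G x0\<close> and
    \<open>0 \<in> \<Delta> 0\<close>.\<close>
  then have "y0 \<in> lagrangian F G \<Delta> x0"
    using in_lagrangianI[of y0 F x0 0 G 0 \<Delta>] x0 by simp
  \<comment> \<open>Nondominance for the Lagrangian program is the multiplier property itself, so
    only attainment at \<open>x0\<close> had to be added.\<close>
  with mult x0(1) show "minimal_at Yp \<Omega> (lagrangian F G \<Delta>) y0 x0"
    by (simp add: minimal_at_def lagrange_multiplier_def)
  show "sv_image \<Delta> (G x0) \<inter> uminus ` Yp \<subseteq> Yp"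
  proof
    fix d
    assume "d \<in> sv_image \<Delta> (G x0) \<inter> uminus ` Yp"
    then obtain z k where dk: "z \<in> G x0" "d \<in> \<Delta> z" "k \<in> Yp" "d = - k"
      by (auto simp: sv_image_def)
    \<comment> \<open>Since \<open>y0 \<in> F x0\<close>, the shifted point
      \<open>y0 + d = y0 - k\<close> is a Lagrangian value in \<open>y0 - Yp\<close>. Nondominance
      puts it in \<open>y0 + Yp\<close>, and cancelling \<open>y0\<close> leaves
      \<open>d \<in> Yp\<close>.\<close>
    have "y0 + d \<in> (\<Union>x\<in>\<Omega>. lagrangian F G \<Delta> x)"
      using in_lagrangianI[of y0 F x0 z G d \<Delta>] x0 dk by blast
    moreover have "y0 + d \<in> (\<lambda>k. y0 - k) ` Yp"
      using dk by auto
    ultimately have "y0 + d \<in> (\<lambda>k. y0 + k) ` Yp"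
      using mult unfolding lagrange_multiplier_def nondominated_def by blast
    then show "d \<in> Yp"
      by auto
  qed
qed

end
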